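(* Let $G=(V,E)$ be a finite, connected, undirected graph (multiple edges allowed) with at least one edge, let $\eta^*$ be the optimal edge usage probabilities for the Fairest Edge Usage problem on $G$, $\eta^*_{\max}=\max_{e\in E}\eta^*(e)$, $E^*=\{e\in E:\eta^*(e)=\eta^*_{\max}\}$, and let $J\subseteq E$ be a critical set for $G$. Then for all $e\in J$, $$\eta^*(e)=\theta(J)=\theta(G)=\theta(E^* )=\eta^*_{\max}.$$
   Context: $\Gamma$ denotes the set of spanning trees of $G$, each viewed as a set of edges. For a probability mass function (pmf) $\mu$ on $\Gamma$, its edge usage probabilities are $\eta(e)=\sum_{\gamma\in\Gamma:\,e\in\gamma}\mu(\gamma)$. The Fairest Edge Usage problem is to minimize $\sum_{e\in E}\eta(e)^2$ over all pmfs $\mu$ on $\Gamma$; all minimizers induce the same edge usage probabilities, denoted $\eta^*$. For $J\subseteq E$, $\mathcal{M}(J)=\min_{\gamma\in\Gamma}|\gamma\cap J|$, and the vulnerability of $J$ is $\theta(J)=\mathcal{M}(J)/|J|$ if $J\neq\emptyset$ and $\theta(\emptyset)=0$. The vulnerability of $G$ is $\theta(G)=\max_{J\subseteq E}\theta(J)$, and $J$ is critical if $\theta(J)=\theta(G)$. *)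

theory Defs
  imports "HOL-Probability.Probability_Mass_Function"
begin

(* Edges are abstract objects, so parallel edges are distinct elements of edges G with the
   same image under ends. Loops (singleton images) are not excluded. *)
record ('v, 'e) multigraph =
  verts :: "'v set"
  edges :: "'e set"
  ends :: "'e \<Rightarrow> 'v set"

definition finite_multigraph :: "('v, 'e) multigraph \<Rightarrow> bool" where
  "finite_multigraph G \<longleftrightarrow>
     finite (verts G) \<and> verts G \<noteq> {} \<and> finite (edges G) \<and>
     (\<forall>e \<in> edges G. \<exists>u \<in> verts G. \<exists>v \<in> verts G. ends G e = {u, v})"

definition connects_verts :: "('v, 'e) multigraph \<Rightarrow> 'e set \<Rightarrow> bool" where
  "connects_verts G F \<longleftrightarrow>
     (\<forall>u \<in> verts G. \<forall>v \<in> verts G. (u, v) \<in> {(x, y). \<exists>e \<in> F. ends G e = {x, y}}\<^sup>*)"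

definition connected_multigraph :: "('v, 'e) multigraph \<Rightarrow> bool" where
  "connected_multigraph G \<longleftrightarrow> connects_verts G (edges G)"

(* The cycle visits the vertices vs in order, the edge es ! i joining vs ! i to its cyclic
   successor. Length 1 is a loop and length 2 is a pair of parallel edges. *)
definition is_cycle :: "('v, 'e) multigraph \<Rightarrow> 'v list \<Rightarrow> 'e list \<Rightarrow> bool" where
  "is_cycle G vs es \<longleftrightarrow>
     es \<noteq> [] \<and> length vs = length es \<and> distinct vs \<and> distinct es \<and>
     (\<forall>i < length es. ends G (es ! i) = {vs ! i, vs ! (Suc i mod length es)})"

definition acyclic_edges :: "('v, 'e) multigraph \<Rightarrow> 'e set \<Rightarrow> bool" where
  "acyclic_edges G F \<longleftrightarrow> \<not> (\<exists>vs es. set es \<subseteq> F \<and> is_cycle G vs es)"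

definition spanning_trees :: "('v, 'e) multigraph \<Rightarrow> 'e set set" where
  "spanning_trees G = {\<gamma>. \<gamma> \<subseteq> edges G \<and> connects_verts G \<gamma> \<and> acyclic_edges G \<gamma>}"

definition tree_pmf :: "('v, 'e) multigraph \<Rightarrow> 'e set pmf \<Rightarrow> bool" where
  "tree_pmf G \<mu> \<longleftrightarrow> set_pmf \<mu> \<subseteq> spanning_trees G"

definition edge_usage :: "('v, 'e) multigraph \<Rightarrow> 'e set pmf \<Rightarrow> 'e \<Rightarrow> real" where
  "edge_usage G \<mu> e = (\<Sum>\<gamma> \<in> {\<gamma> \<in> spanning_trees G. e \<in> \<gamma>}. pmf \<mu> \<gamma>)"

definition FEU_objective :: "('v, 'e) multigraph \<Rightarrow> 'e set pmf \<Rightarrow> real" where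
  "FEU_objective G \<mu> = (\<Sum>e \<in> edges G. (edge_usage G \<mu> e)\<^sup>2)"

definition FEU_optimal :: "('v, 'e) multigraph \<Rightarrow> 'e set pmf \<Rightarrow> bool" where
  "FEU_optimal G \<mu> \<longleftrightarrow>
     tree_pmf G \<mu> \<and> (\<forall>\<nu>. tree_pmf G \<nu> \<longrightarrow> FEU_objective G \<mu> \<le> FEU_objective G \<nu>)"

definition min_overlap :: "('v, 'e) multigraph \<Rightarrow> 'e set \<Rightarrow> nat" where
  "min_overlap G J = Min ((\<lambda>\<gamma>. card (\<gamma> \<inter> J)) ` spanning_trees G)"

definition vulnerability :: "('v, 'e) multigraph \<Rightarrow> 'e set \<Rightarrow> real" where
  "vulnerability G J = (if J = {} then 0 else real (min_overlap G J) / real (card J))"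

definition graph_vulnerability :: "('v, 'e) multigraph \<Rightarrow> real" where
  "graph_vulnerability G = Max (vulnerability G ` Pow (edges G))"

definition critical_set :: "('v, 'e) multigraph \<Rightarrow> 'e set \<Rightarrow> bool" where
  "critical_set G J \<longleftrightarrow> J \<subseteq> edges G \<and> vulnerability G J = graph_vulnerability G"

definition max_usage :: "('v, 'e) multigraph \<Rightarrow> ('e \<Rightarrow> real) \<Rightarrow> real" where
  "max_usage G \<eta> = Max (\<eta> ` edges G)"

definition max_usage_edges :: "('v, 'e) multigraph \<Rightarrow> ('e \<Rightarrow> real) \<Rightarrow> 'e set" where
  "max_usage_edges G \<eta> = {e \<in> edges G. \<eta> e = max_usage G \<eta>}"

end

(* Perturbing an optimal pmf towards a spanning tree shows that its support consists of trees of
   minimum weight for the weights eta. By symmetric exchange, a minimum weight tree uses the fewest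
   possible edges of the set K of edges of maximum usage, so averaging the overlap with K over the
   optimal pmf gives theta(K) = eta_max. The same averaging over any J gives
   M(J) <= eta(J) <= |J| eta_max, and a critical J makes both inequalities tight. *)
theory Submission
  imports Defs
begin

section \<open>Exchange of edges between spanning trees\<close>

definition edge_rel :: "('v, 'e) multigraph \<Rightarrow> 'e set \<Rightarrow> ('v \<times> 'v) set" where
  "edge_rel G F = {(x, y). \<exists>e \<in> F. ends G e = {x, y}}"

lemma connects_verts_iff:
  "connects_verts G F \<longleftrightarrow> (\<forall>u \<in> verts G. \<forall>v \<in> verts G. (u, v) \<in> (edge_rel G F)\<^sup>*)"
  by (simp add: connects_verts_def edge_rel_def)

lemma edge_rel_rtrancl_sym:
  "(x, y) \<in> (edge_rel G F)\<^sup>* \<Longrightarrow> (y, x) \<in> (edge_rel G F)\<^sup>*"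
  by (rule symD[OF sym_rtrancl]) (auto simp: sym_def edge_rel_def insert_commute)

lemma edge_rel_rtrancl_mono:
  "(x, y) \<in> (edge_rel G F)\<^sup>* \<Longrightarrow> F \<subseteq> F' \<Longrightarrow> (x, y) \<in> (edge_rel G F')\<^sup>*"
  by (erule subsetD[OF rtrancl_mono, rotated]) (auto simp: edge_rel_def)

lemma edge_rel_rtrancl_edge:
  "e \<in> F \<Longrightarrow> ends G e = {x, y} \<Longrightarrow> (x, y) \<in> (edge_rel G F)\<^sup>*"
  by (rule r_into_rtrancl) (auto simp: edge_rel_def)

text \<open>Edges are listed besides vertices because parallel edges share their ends. The indexing
  follows \<open>is_cycle\<close>, so one more edge between \<open>v\<close> and \<open>u\<close>
  closes the path to a cycle.\<close>

definition is_simple_path ::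
    "('v, 'e) multigraph \<Rightarrow> 'e set \<Rightarrow> 'v \<Rightarrow> 'v \<Rightarrow> 'v list \<Rightarrow> 'e list \<Rightarrow> bool" where
  "is_simple_path G F u v vs es \<longleftrightarrow>
     distinct vs \<and> distinct es \<and> set es \<subseteq> F \<and> length vs = Suc (length es) \<and>
     vs ! 0 = u \<and> vs ! length es = v \<and>
     (\<forall>i < length es. ends G (es ! i) = {vs ! i, vs ! Suc i})"

lemma simple_path_exists:
  assumes "(u, v) \<in> (edge_rel G F)\<^sup>*"
  shows "\<exists>vs es. is_simple_path G F u v vs es"
  using assms
proof (induction rule: rtrancl_induct)
  case base
  have "is_simple_path G F u u [u] []"
    by (simp add: is_simple_path_def)
  then show ?case by blast
next
  case (step y z)
  then obtain vs es e where p: "is_simple_path G F u y vs es"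
    and e: "e \<in> F" "ends G e = {y, z}" unfolding edge_rel_def by blast
  show ?case
  proof (cases "z \<in> set vs")
    case True
    then obtain k where k: "k < length vs" "vs ! k = z"
      by (auto simp: in_set_conv_nth)
    \<comment> \<open>A revisited vertex cuts the path short at its first visit.\<close>
    have "is_simple_path G F u z (take (Suc k) vs) (take k es)"
      using p k set_take_subset[of k es] by (auto simp: is_simple_path_def)
    then show ?thesis by blast
  next
    case False
    \<comment> \<open>An edge already on the path would put both its ends, and so \<open>z\<close>,
      on the path.\<close>
    have "e \<notin> set es"
    proof
      assume "e \<in> set es"
      then obtain i where "i < length es" "es ! i = e"
        by (auto simp: in_set_conv_nth)
      with p e have "z \<in> {vs ! i, vs ! Suc i}" "Suc i < length vs"
        by (auto simp: is_simple_path_def)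
      with False show False by auto
    qed
    then have "is_simple_path G F u z (vs @ [z]) (es @ [e])"
      using p e False by (auto simp: is_simple_path_def nth_append less_Suc_eq)
    then show ?thesis by blast
  qed
qed

text \<open>Only the edges between positions \<open>j\<close> and \<open>k\<close> have to lie in
  \<open>F'\<close>. This serves to show that the two pieces of a path around an edge avoid that
  edge.\<close>

lemma simple_path_segment:
  assumes "is_simple_path G F u v vs es"
    and "k \<le> length es" "j \<le> k" "\<And>i. j \<le> i \<Longrightarrow> i < k \<Longrightarrow> es ! i \<in> F'"
  shows "(vs ! j, vs ! k) \<in> (edge_rel G F')\<^sup>*"
  using assms(3,2,4)
proof (induction k rule: dec_induct)
  case (step k)
  then have "ends G (es ! k) = {vs ! k, vs ! Suc k}" "es ! k \<in> F'"
    using assms(1) by (auto simp: is_simple_path_def)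
  then have "(vs ! k, vs ! Suc k) \<in> (edge_rel G F')\<^sup>*"
    by (rule edge_rel_rtrancl_edge[rotated])
  moreover have "(vs ! j, vs ! k) \<in> (edge_rel G F')\<^sup>*"
    using step by simp
  ultimately show ?case by (rule rtrancl_trans[rotated])
qed simp

section \<open>Cycles and reachability after deleting an edge\<close>

lemma acyclic_edgesD:
  assumes "acyclic_edges G F" "e \<in> F" "ends G e = {u, v}"
  shows "(u, v) \<notin> (edge_rel G (F - {e}))\<^sup>*"
proof
  assume "(u, v) \<in> (edge_rel G (F - {e}))\<^sup>*"
  then obtain vs es where p: "is_simple_path G (F - {e}) u v vs es"
    using simple_path_exists by metis
  have "ends G ((es @ [e]) ! i) = {vs ! i, vs ! (Suc i mod length (es @ [e]))}"
    if "i < length (es @ [e])" for i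
  proof (cases "i = length es")
    \<comment> \<open>The appended edge \<open>e\<close> joins the last vertex \<open>v\<close> to
      the first vertex \<open>u\<close>: its successor index wraps around to 0. For a loop the path
      is trivial and the cycle has length 1.\<close>
    case True
    then show ?thesis using p assms(3) by (auto simp: is_simple_path_def)
  next
    case False
    with that have "i < length es" by simp
    then have "Suc i mod length (es @ [e]) = Suc i" by (intro mod_less) simp
    with \<open>i < length es\<close> p show ?thesis by (simp add: is_simple_path_def nth_append)
  qed
  then have "is_cycle G vs (es @ [e])"
    using p by (auto simp: is_simple_path_def is_cycle_def)
  moreover have "set (es @ [e]) \<subseteq> F"
    using p assms(2) by (auto simp: is_simple_path_def)
  ultimately show False
    using assms(1) unfolding acyclic_edges_def by blast
qed

text \<open>Going round the cycle from one end of \<open>e\<close> to the other passes every edge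
  except \<open>e\<close>. This is the converse direction to \<open>acyclic_edgesD\<close>.\<close>

lemma cycle_edge_ends_connected:
  assumes "is_cycle G vs es" "e \<in> set es" "ends G e = {u, v}"
  shows "(u, v) \<in> (edge_rel G (set es - {e}))\<^sup>*"
proof -
  define n where "n = length es"
  obtain i where i: "i < n" "es ! i = e"
    using assms(2) by (auto simp: in_set_conv_nth n_def)
  have d: "distinct es" and len: "length vs = n"
    and E: "\<And>j. j < n \<Longrightarrow> ends G (es ! j) = {vs ! j, vs ! (Suc j mod n)}"
    using assms(1) by (auto simp: is_cycle_def n_def)
  \<comment> \<open>The walk starts just behind edge \<open>i\<close>; fewer than \<open>n\<close>
    steps never traverse that edge.\<close>
  have *: "(vs ! (Suc i mod n), vs ! ((Suc i + k) mod n)) \<in> (edge_rel G (set es - {e}))\<^sup>*"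
    if "k < n" for k
    using that
  proof (induction k)
    case (Suc k)
    let ?j = "(Suc i + k) mod n"
    have j: "?j < n" using Suc.prems by simp
    \<comment> \<open>Being back at index \<open>i\<close> would make \<open>Suc k\<close> a
      multiple of \<open>n\<close>, but \<open>0 < Suc k < n\<close>.\<close>
    have "?j \<noteq> i"
    proof
      assume "?j = i"
      then have "(i + Suc k) mod n = (i + 0) mod n" using i by simp
      then have "Suc k mod n = 0 mod n"
        by (metis add_diff_cancel_left' mod_eq_dvd_iff_nat le_add1 diff_zero)
      then show False using Suc.prems by simp
    qed
    then have e': "es ! ?j \<in> set es - {e}"
      using d i j by (auto simp: n_def nth_eq_iff_index_eq)
    have "ends G (es ! ?j) = {vs ! ?j, vs ! ((Suc i + Suc k) mod n)}"
      using E[OF j] by (simp add: mod_Suc_eq)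
    with e' have "(vs ! ?j, vs ! ((Suc i + Suc k) mod n)) \<in> (edge_rel G (set es - {e}))\<^sup>*"
      by (rule edge_rel_rtrancl_edge)
    moreover have "(vs ! (Suc i mod n), vs ! ?j) \<in> (edge_rel G (set es - {e}))\<^sup>*"
      using Suc by simp
    ultimately show ?case by (rule rtrancl_trans[rotated])
  qed simp
  have "(vs ! (Suc i mod n), vs ! i) \<in> (edge_rel G (set es - {e}))\<^sup>*"
    \<comment> \<open>After \<open>n - 1\<close> steps the index is \<open>i + n\<close>, which is
      \<open>i\<close> modulo \<open>n\<close>.\<close>
    using *[of "n - 1"] i by simp
  moreover have "{u, v} = {vs ! i, vs ! (Suc i mod n)}"
    using E[of i] i assms(3) by simp
  ultimately show ?thesis
    by (auto simp: doubleton_eq_iff intro: edge_rel_rtrancl_sym)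
qed

text \<open>Deleting \<open>e\<close> splits \<open>T\<close> into the side of \<open>x\<close> and
  the side of \<open>y\<close>. The last two hypotheses say that \<open>f\<close> joins these sides,
  with its ends named accordingly.\<close>

lemma spanning_tree_exchange:
  assumes T: "T \<in> spanning_trees G"
    and e: "e \<in> T" "ends G e = {x, y}"
    and f: "f \<in> edges G" "ends G f = {u, v}"
    and xu: "(x, u) \<in> (edge_rel G (T - {e}))\<^sup>*"
    and vy: "(v, y) \<in> (edge_rel G (T - {e}))\<^sup>*"
  shows "insert f (T - {e}) \<in> spanning_trees G"
proof -
  let ?T' = "insert f (T - {e})"
  have T': "T \<subseteq> edges G" "connects_verts G T" "acyclic_edges G T"
    using T by (auto simp: spanning_trees_def)
  have "(x, u) \<in> (edge_rel G ?T')\<^sup>*" "(u, v) \<in> (edge_rel G ?T')\<^sup>*" "(v, y) \<in> (edge_rel G ?T')\<^sup>*"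
    using edge_rel_rtrancl_mono[OF xu] edge_rel_rtrancl_mono[OF vy]
      edge_rel_rtrancl_edge[of f ?T', OF _ f(2)] by blast+
  then have xy: "(x, y) \<in> (edge_rel G ?T')\<^sup>*" by (meson rtrancl_trans)
  \<comment> \<open>Only \<open>e\<close> needs a detour in \<open>?T'\<close>, namely from
    \<open>x\<close> via \<open>u\<close> and \<open>v\<close> to \<open>y\<close>.\<close>
  have "edge_rel G T \<subseteq> (edge_rel G ?T')\<^sup>*"
  proof
    fix p assume "p \<in> edge_rel G T"
    then obtain a b g where p: "p = (a, b)" and g: "g \<in> T" "ends G g = {a, b}"
      unfolding edge_rel_def by blast
    have "(a, b) \<in> (edge_rel G ?T')\<^sup>*"
    proof (cases "g = e")
      case True
      with g e have "{a, b} = {x, y}" by simp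
      with xy show ?thesis
        by (auto simp: doubleton_eq_iff intro: edge_rel_rtrancl_sym)
    next
      case False
      with g show ?thesis by (intro edge_rel_rtrancl_edge) auto
    qed
    with p show "p \<in> (edge_rel G ?T')\<^sup>*" by simp
  qed
  then have "(edge_rel G T)\<^sup>* \<subseteq> (edge_rel G ?T')\<^sup>*"
    by (rule rtrancl_subset_rtrancl)
  with T'(2) have "connects_verts G ?T'"
    unfolding connects_verts_iff by blast
  moreover have "acyclic_edges G ?T'"
    unfolding acyclic_edges_def
  proof clarify
    fix vs es assume c: "set es \<subseteq> ?T'" "is_cycle G vs es"
    show False
    proof (cases "f \<in> set es")
      case True
      \<comment> \<open>The rest of a cycle through \<open>f\<close> would join the two sides inside
        \<open>T - {e}\<close>, so \<open>e\<close> would close a cycle in \<open>T\<close>.\<close>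
      have "(u, v) \<in> (edge_rel G (T - {e}))\<^sup>*"
        using edge_rel_rtrancl_mono[OF cycle_edge_ends_connected[OF c(2) True f(2)]] c(1) by blast
      with xu vy have "(x, y) \<in> (edge_rel G (T - {e}))\<^sup>*" by (meson rtrancl_trans)
      with acyclic_edgesD[OF T'(3) e] show False ..
    next
      case False
      with c T'(3) show False unfolding acyclic_edges_def by blast
    qed
  qed
  ultimately show ?thesis
    using T'(1) f(1) by (auto simp: spanning_trees_def)
qed

text \<open>Deleting an edge splits a component into at most two pieces, one around each end. Along
  the walk, crossing \<open>f\<close> just restarts at one of its ends.\<close>

lemma connected_to_deleted_edge_end:
  assumes "(u, z) \<in> (edge_rel G F)\<^sup>*" "ends G f = {u, v}"
  shows "(u, z) \<in> (edge_rel G (F - {f}))\<^sup>* \<or> (v, z) \<in> (edge_rel G (F - {f}))\<^sup>*"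
  using assms(1)
proof (induction rule: rtrancl_induct)
  case (step y z)
  then obtain g where g: "g \<in> F" "ends G g = {y, z}" unfolding edge_rel_def by blast
  show ?case
  proof (cases "g = f")
    case True
    then show ?thesis using g assms(2) by (auto simp: doubleton_eq_iff)
  next
    case False
    with g have "(y, z) \<in> (edge_rel G (F - {f}))\<^sup>*"
      by (intro edge_rel_rtrancl_edge) auto
    with step.IH show ?thesis by (meson rtrancl_trans)
  qed
qed simp

text \<open>Deleting \<open>f\<close> from \<open>S\<close> defines a cut separating
  \<open>u\<close> from \<open>v\<close>. The path of \<open>T\<close> between them crosses it in an
  edge \<open>e\<close>. Lying on that path, \<open>e\<close> can be replaced by \<open>f\<close> in
  \<open>T\<close>; crossing the cut, it can replace \<open>f\<close> in \<open>S\<close>.\<close>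

lemma spanning_tree_symmetric_exchange:
  assumes G: "finite_multigraph G"
    and S: "S \<in> spanning_trees G" and T: "T \<in> spanning_trees G"
    and f: "f \<in> S" "f \<notin> T"
  obtains e where "e \<in> T" "e \<notin> S"
    "insert e (S - {f}) \<in> spanning_trees G" "insert f (T - {e}) \<in> spanning_trees G"
proof -
  have S': "S \<subseteq> edges G" "connects_verts G S" "acyclic_edges G S"
    and T': "T \<subseteq> edges G" "connects_verts G T"
    using S T by (auto simp: spanning_trees_def)
  obtain u v where uv: "u \<in> verts G" "v \<in> verts G" "ends G f = {u, v}"
    using G f(1) S'(1) unfolding finite_multigraph_def by blast
  \<comment> \<open>The side of \<open>u\<close> in the cut.\<close>
  define A where "A = {z. (u, z) \<in> (edge_rel G (S - {f}))\<^sup>*}"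
  have v: "v \<notin> A"
    using acyclic_edgesD[OF S'(3) f(1) uv(3)] by (simp add: A_def)
  obtain vs es where p: "is_simple_path G T u v vs es"
    using simple_path_exists[of u v G T] T'(2) uv unfolding connects_verts_iff by blast
  \<comment> \<open>The first edge of the path that leaves \<open>A\<close>; minimality puts its
    near end \<open>vs ! i\<close> in \<open>A\<close>.\<close>
  define i where "i = (LEAST i. vs ! Suc i \<notin> A)"
  have u_A: "vs ! 0 \<in> A" and last: "vs ! length es \<notin> A"
    using p v by (auto simp: is_simple_path_def A_def)
  obtain m where m: "length es = Suc m"
    using u_A last by (cases "length es") auto
  have i: "vs ! Suc i \<notin> A" "i \<le> m"
    using LeastI[of "\<lambda>i. vs ! Suc i \<notin> A" m] Least_le[of "\<lambda>i. vs ! Suc i \<notin> A" m] last m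
    by (auto simp: i_def)
  have iA: "vs ! i \<in> A"
  proof (cases i)
    case (Suc j)
    then show ?thesis using not_less_Least[of j "\<lambda>i. vs ! Suc i \<notin> A"] by (auto simp: i_def)
  qed (use u_A in simp)
  define e x y where "e = es ! i" and "x = vs ! i" and "y = vs ! Suc i"
  have e: "e \<in> T" "ends G e = {x, y}"
    using p i m by (auto simp: is_simple_path_def e_def x_def y_def)
  \<comment> \<open>Edges of a simple path are distinct, so the pieces before and after
    \<open>e\<close> avoid \<open>e\<close>.\<close>
  have other: "es ! j \<in> T - {e}" if "j < length es" "j \<noteq> i" for j
    using p i m that by (auto simp: is_simple_path_def e_def nth_eq_iff_index_eq)
  have "(vs ! 0, x) \<in> (edge_rel G (T - {e}))\<^sup>*"
    unfolding x_def using p by (rule simple_path_segment) (use i m other in auto)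
  then have ux: "(u, x) \<in> (edge_rel G (T - {e}))\<^sup>*"
    using p by (simp add: is_simple_path_def)
  have "(y, vs ! length es) \<in> (edge_rel G (T - {e}))\<^sup>*"
    unfolding y_def using p by (rule simple_path_segment) (use i m other in auto)
  then have yv: "(y, v) \<in> (edge_rel G (T - {e}))\<^sup>*"
    using p by (simp add: is_simple_path_def)
  have T_new: "insert f (T - {e}) \<in> spanning_trees G"
    using T e _ uv(3) edge_rel_rtrancl_sym[OF ux] edge_rel_rtrancl_sym[OF yv]
    by (rule spanning_tree_exchange) (use f S' in auto)
  have Sux: "(u, x) \<in> (edge_rel G (S - {f}))\<^sup>*" and y: "y \<notin> A"
    using i iA by (auto simp: A_def x_def y_def)
  have "e \<notin> S"
  proof
    assume "e \<in> S"
    then have "(x, y) \<in> (edge_rel G (S - {f}))\<^sup>*"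
      using e f by (intro edge_rel_rtrancl_edge) auto
    with Sux y show False unfolding A_def by (auto intro: rtrancl_trans)
  qed
  have "y \<in> verts G"
    using G e T'(1) unfolding finite_multigraph_def by (fastforce simp: doubleton_eq_iff)
  then have "(u, y) \<in> (edge_rel G S)\<^sup>*"
    using S'(2) uv(1) unfolding connects_verts_iff by blast
  \<comment> \<open>Since \<open>y\<close> is not on the side of \<open>u\<close>, it must be on the
    side of \<open>v\<close>.\<close>
  then have Svy: "(v, y) \<in> (edge_rel G (S - {f}))\<^sup>*"
    using connected_to_deleted_edge_end[OF _ uv(3)] y unfolding A_def by blast
  have "insert e (S - {f}) \<in> spanning_trees G"
    using S f(1) uv(3) _ e(2) Sux edge_rel_rtrancl_sym[OF Svy]
    by (rule spanning_tree_exchange) (use e T' in auto)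
  with T_new \<open>e \<notin> S\<close> e(1) that show thesis by blast
qed

section \<open>Minimum weight trees and optimal usage\<close>

lemma finite_spanning_trees:
  "finite_multigraph G \<Longrightarrow> finite (spanning_trees G)"
  by (rule finite_subset[of _ "Pow (edges G)"]) (auto simp: spanning_trees_def finite_multigraph_def)

lemma finite_spanning_tree:
  "finite_multigraph G \<Longrightarrow> T \<in> spanning_trees G \<Longrightarrow> finite T"
  by (rule finite_subset[of _ "edges G"]) (auto simp: spanning_trees_def finite_multigraph_def)

text \<open>\<open>K\<close> is closed upwards in weight. Exchanging some \<open>f\<close> of
  \<open>S\<close> into \<open>T\<close> for a suitable \<open>e\<close> brings \<open>T\<close>
  closer to \<open>S\<close>. Minimality of \<open>S\<close> gives \<open>w f \<le> w e\<close>, so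
  if \<open>f\<close> enters \<open>K\<close>, then \<open>e\<close> leaves it, and the overlap with
  \<open>K\<close> does not grow.\<close>

lemma min_weight_tree_card_max_edges_le:
  fixes w :: "'e \<Rightarrow> real"
  assumes G: "finite_multigraph G"
    and S: "S \<in> spanning_trees G"
    and min: "\<And>T. T \<in> spanning_trees G \<Longrightarrow> sum w S \<le> sum w T"
    and K: "\<And>e f. e \<in> edges G \<Longrightarrow> f \<in> K \<Longrightarrow> w f \<le> w e \<Longrightarrow> e \<in> K"
    and T: "T \<in> spanning_trees G"
  shows "card (S \<inter> K) \<le> card (T \<inter> K)"
  using T
proof (induction "card (S - T)" arbitrary: T rule: less_induct)
  case less
  note fin = finite_spanning_tree[OF G]
  show ?case
  proof (cases "S \<subseteq> T")
    case True
    then show ?thesis using fin[OF less.prems] by (intro card_mono) auto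
  next
    case False
    then obtain f where f: "f \<in> S" "f \<notin> T" by blast
    obtain e where e: "e \<in> T" "e \<notin> S" "insert e (S - {f}) \<in> spanning_trees G"
        "insert f (T - {e}) \<in> spanning_trees G"
      using spanning_tree_symmetric_exchange[OF G S less.prems f] by blast
    let ?T' = "insert f (T - {e})"
    have "S - ?T' \<subset> S - T" using f e by blast
    then have "card (S - ?T') < card (S - T)"
      using fin[OF S] by (intro psubset_card_mono) auto
    then have IH: "card (S \<inter> K) \<le> card (?T' \<inter> K)"
      using less.hyps e(4) by blast
    \<comment> \<open>The other half of the symmetric exchange, \<open>S\<close> with
      \<open>f\<close> replaced by \<open>e\<close>, weighs no less than \<open>S\<close>.\<close>
    have "sum w S \<le> w e + sum w (S - {f})"
      using min[OF e(3)] fin[OF S] e(2) by simp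
    then have "w f \<le> w e"
      using fin[OF S] f(1) by (simp add: sum_diff1)
    moreover have "e \<in> edges G" using e(1) less.prems by (auto simp: spanning_trees_def)
    ultimately have "f \<in> K \<Longrightarrow> e \<in> K" using K by blast
    have "card (?T' \<inter> K) \<le> card (T \<inter> K)"
    proof (cases "f \<in> K")
      case True
      with \<open>f \<in> K \<Longrightarrow> e \<in> K\<close> have "e \<in> K" by blast
      have "?T' \<inter> K = insert f (T \<inter> K - {e})" using True by blast
      also have "card \<dots> \<le> Suc (card (T \<inter> K - {e}))"
        by (simp add: card_insert_le_m1 card_insert_if)
      also have "\<dots> = card (T \<inter> K)"
        using fin[OF less.prems] e(1) \<open>e \<in> K\<close> by (intro card_Suc_Diff1) auto
      finally show ?thesis .
    next
      case False
      then show ?thesis using fin[OF less.prems] by (intro card_mono) auto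
    qed
    with IH show ?thesis by linarith
  qed
qed

section \<open>Expectations over random spanning trees\<close>

lemma sum_pmf_spanning_trees:
  assumes "finite_multigraph G" "tree_pmf G \<mu>"
  shows "(\<Sum>\<gamma> \<in> spanning_trees G. pmf \<mu> \<gamma>) = 1"
  using assms by (intro sum_pmf_eq_1 finite_spanning_trees) (auto simp: tree_pmf_def)

lemma edge_usage_eq_sum:
  assumes "finite_multigraph G"
  shows "edge_usage G \<mu> e = (\<Sum>\<gamma> \<in> spanning_trees G. pmf \<mu> \<gamma> * of_bool (e \<in> \<gamma>))"
  unfolding edge_usage_def using finite_spanning_trees[OF assms]
  by (intro sum.mono_neutral_cong_left) auto

text \<open>Linearity of expectation. Weight 1 yields the expected overlap with \<open>J\<close>;
  the usage itself as weight on all edges yields \<open>FEU_objective\<close>.\<close>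

lemma expected_weight:
  fixes w :: "'e \<Rightarrow> real"
  assumes G: "finite_multigraph G" and J: "J \<subseteq> edges G"
  shows "(\<Sum>\<gamma> \<in> spanning_trees G. pmf \<mu> \<gamma> * sum w (\<gamma> \<inter> J)) = (\<Sum>e \<in> J. w e * edge_usage G \<mu> e)"
proof -
  have "finite J" using G J finite_subset unfolding finite_multigraph_def by blast
  then have w: "sum w (\<gamma> \<inter> J) = (\<Sum>e \<in> J. w e * of_bool (e \<in> \<gamma>))" for \<gamma>
    by (intro sum.mono_neutral_cong_left) auto
  have "(\<Sum>\<gamma> \<in> spanning_trees G. pmf \<mu> \<gamma> * sum w (\<gamma> \<inter> J)) =
      (\<Sum>\<gamma> \<in> spanning_trees G. \<Sum>e \<in> J. pmf \<mu> \<gamma> * (w e * of_bool (e \<in> \<gamma>)))"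
    by (simp only: w sum_distrib_left)
  also have "\<dots> = (\<Sum>e \<in> J. \<Sum>\<gamma> \<in> spanning_trees G. pmf \<mu> \<gamma> * (w e * of_bool (e \<in> \<gamma>)))"
    by (rule sum.swap)
  also have "\<dots> = (\<Sum>e \<in> J. w e * edge_usage G \<mu> e)"
    unfolding edge_usage_eq_sum[OF G] sum_distrib_left by (simp add: mult.left_commute)
  finally show ?thesis .
qed

lemma expected_card:
  assumes "finite_multigraph G" "J \<subseteq> edges G"
  shows "(\<Sum>\<gamma> \<in> spanning_trees G. pmf \<mu> \<gamma> * real (card (\<gamma> \<inter> J))) = (\<Sum>e \<in> J. edge_usage G \<mu> e)"
  using expected_weight[OF assms, of \<mu> "\<lambda>_. 1"] by simp

section \<open>First-order optimality conditions\<close>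

lemma edge_usage_mixture:
  fixes t :: real
  assumes G: "finite_multigraph G" and \<mu>: "tree_pmf G \<mu>" and T: "T \<in> spanning_trees G"
    and t: "0 \<le> t" "t \<le> 1"
  obtains \<nu> where "tree_pmf G \<nu>"
    "\<And>e. edge_usage G \<nu> e = t * of_bool (e \<in> T) + (1 - t) * edge_usage G \<mu> e"
proof
  \<comment> \<open>A biased coin decides between the fixed tree \<open>T\<close> and a sample from
    \<open>\<mu>\<close>.\<close>
  define \<nu> where "\<nu> = bind_pmf (bernoulli_pmf t) (\<lambda>b. if b then return_pmf T else \<mu>)"
  show "tree_pmf G \<nu>"
    using \<mu> T by (auto simp: tree_pmf_def \<nu>_def split: if_splits)
  have pmf_\<nu>: "pmf \<nu> \<gamma> = t * of_bool (\<gamma> = T) + (1 - t) * pmf \<mu> \<gamma>" for \<gamma>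
    using t by (simp add: \<nu>_def pmf_bind)
  fix e
  have "edge_usage G \<nu> e = (\<Sum>\<gamma> \<in> spanning_trees G.
      t * (of_bool (\<gamma> = T) * of_bool (e \<in> \<gamma>)) + (1 - t) * (pmf \<mu> \<gamma> * of_bool (e \<in> \<gamma>)))"
    unfolding edge_usage_eq_sum[OF G] pmf_\<nu> by (simp add: algebra_simps)
  also have "\<dots> = t * (\<Sum>\<gamma> \<in> spanning_trees G. of_bool (\<gamma> = T) * of_bool (e \<in> \<gamma>))
      + (1 - t) * edge_usage G \<mu> e"
    unfolding edge_usage_eq_sum[OF G] by (simp only: sum.distrib sum_distrib_left)
  also have "(\<Sum>\<gamma> \<in> spanning_trees G. of_bool (\<gamma> = T) * of_bool (e \<in> \<gamma>) :: real) =
      (\<Sum>\<gamma> \<in> spanning_trees G. if \<gamma> = T then of_bool (e \<in> T) else 0)"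
    by (intro sum.cong) auto
  also have "\<dots> = of_bool (e \<in> T)"
    using T finite_spanning_trees[OF G] by simp
  finally show "edge_usage G \<nu> e = t * of_bool (e \<in> T) + (1 - t) * edge_usage G \<mu> e" .
qed

lemma nonneg_if_quadratic_nonneg:
  fixes a b :: real
  assumes "\<And>t. 0 < t \<Longrightarrow> t \<le> 1 \<Longrightarrow> 0 \<le> 2 * t * a + t\<^sup>2 * b"
  shows "0 \<le> a"
proof (rule ccontr)
  assume "\<not> 0 \<le> a"
  \<comment> \<open>Small enough that \<open>t * b \<le> - a\<close>, whence
    \<open>2 * a + t * b \<le> a < 0\<close>.\<close>
  define t where "t = min 1 (- a / (\<bar>b\<bar> + 1))"
  have t: "0 < t" "t \<le> 1" and "t \<le> - a / (\<bar>b\<bar> + 1)"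
    using \<open>\<not> 0 \<le> a\<close> by (auto simp: t_def divide_less_0_iff)
  then have "t * (\<bar>b\<bar> + 1) \<le> - a" by (subst (asm) pos_le_divide_eq) auto
  moreover have "t * b \<le> t * (\<bar>b\<bar> + 1)" using t by (intro mult_left_mono) auto
  ultimately have "2 * a + t * b < 0" using \<open>\<not> 0 \<le> a\<close> by linarith
  with t have "t * (2 * a + t * b) < 0" by (intro mult_pos_neg)
  with assms[OF t] show False by (simp add: algebra_simps power2_eq_square)
qed

text \<open>Moving from \<open>\<mu>\<close> towards \<open>T\<close> changes the usage in direction
  \<open>d\<close>. By optimality the derivative of the objective, twice the inner product of usage
  and \<open>d\<close>, is nonnegative; that inner product is the weight of \<open>T\<close> minus
  the objective.\<close>

lemma FEU_optimal_weight_ge: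
  assumes G: "finite_multigraph G" and opt: "FEU_optimal G \<mu>" and T: "T \<in> spanning_trees G"
  shows "FEU_objective G \<mu> \<le> sum (edge_usage G \<mu>) T"
proof -
  let ?\<eta> = "edge_usage G \<mu>"
  define d where "d e = of_bool (e \<in> T) - ?\<eta> e" for e
  have \<mu>: "tree_pmf G \<mu>" using opt by (simp add: FEU_optimal_def)
  have "0 \<le> (\<Sum>e \<in> edges G. ?\<eta> e * d e)"
  proof (rule nonneg_if_quadratic_nonneg)
    fix t :: real assume t: "0 < t" "t \<le> 1"
    obtain \<nu> where \<nu>: "tree_pmf G \<nu>"
      "\<And>e. edge_usage G \<nu> e = t * of_bool (e \<in> T) + (1 - t) * ?\<eta> e"
      by (rule edge_usage_mixture[OF G \<mu> T less_imp_le[OF t(1)] t(2)], rule that)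
    have "edge_usage G \<nu> e = ?\<eta> e + t * d e" for e
      by (simp add: \<nu>(2) d_def algebra_simps)
    then have "FEU_objective G \<nu> = (\<Sum>e \<in> edges G. (?\<eta> e)\<^sup>2 + (2 * t * (?\<eta> e * d e) + t\<^sup>2 * (d e)\<^sup>2))"
      unfolding FEU_objective_def by (simp add: power2_eq_square algebra_simps)
    also have "\<dots> = FEU_objective G \<mu>
        + (2 * t * (\<Sum>e \<in> edges G. ?\<eta> e * d e) + t\<^sup>2 * (\<Sum>e \<in> edges G. (d e)\<^sup>2))"
      by (simp only: sum.distrib sum_distrib_left FEU_objective_def)
    finally have "FEU_objective G \<nu> = \<dots>" .
    moreover have "FEU_objective G \<mu> \<le> FEU_objective G \<nu>"
      using opt \<nu>(1) by (simp add: FEU_optimal_def)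
    ultimately show "0 \<le> 2 * t * (\<Sum>e \<in> edges G. ?\<eta> e * d e) + t\<^sup>2 * (\<Sum>e \<in> edges G. (d e)\<^sup>2)"
      by linarith
  qed
  also have "\<dots> = (\<Sum>e \<in> edges G. ?\<eta> e * of_bool (e \<in> T)) - FEU_objective G \<mu>"
    unfolding FEU_objective_def d_def
    by (simp add: right_diff_distrib sum_subtractf power2_eq_square)
  also have "(\<Sum>e \<in> edges G. ?\<eta> e * of_bool (e \<in> T)) = sum ?\<eta> T"
    using G T by (intro sum.mono_neutral_cong_right)
      (auto simp: finite_multigraph_def spanning_trees_def)
  finally show ?thesis by simp
qed

text \<open>The objective is the mean tree weight under \<open>\<mu>\<close> and also a lower bound
  for every tree weight, so no tree of the support can exceed it.\<close>

lemma FEU_optimal_support_weight: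
  assumes G: "finite_multigraph G" and opt: "FEU_optimal G \<mu>" and S: "S \<in> set_pmf \<mu>"
  shows "sum (edge_usage G \<mu>) S = FEU_objective G \<mu>"
proof -
  let ?W = "sum (edge_usage G \<mu>)" and ?C = "FEU_objective G \<mu>"
  have \<mu>: "tree_pmf G \<mu>" using opt by (simp add: FEU_optimal_def)
  have S': "S \<in> spanning_trees G" using \<mu> S by (auto simp: tree_pmf_def)
  have "(\<Sum>\<gamma> \<in> spanning_trees G. pmf \<mu> \<gamma> * ?W \<gamma>) =
      (\<Sum>\<gamma> \<in> spanning_trees G. pmf \<mu> \<gamma> * ?W (\<gamma> \<inter> edges G))"
    by (intro sum.cong refl) (auto simp: spanning_trees_def Int_absorb2)
  also have "\<dots> = ?C"
    unfolding expected_weight[OF G subset_refl] by (simp add: FEU_objective_def power2_eq_square)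
  finally have "(\<Sum>\<gamma> \<in> spanning_trees G. pmf \<mu> \<gamma> * (?W \<gamma> - ?C)) = 0"
    by (simp add: right_diff_distrib sum_subtractf sum_pmf_spanning_trees[OF G \<mu>]
        flip: sum_distrib_right)
  moreover have "0 \<le> pmf \<mu> \<gamma> * (?W \<gamma> - ?C)" if "\<gamma> \<in> spanning_trees G" for \<gamma>
    using FEU_optimal_weight_ge[OF G opt that] by simp
  ultimately have "\<forall>\<gamma> \<in> spanning_trees G. pmf \<mu> \<gamma> * (?W \<gamma> - ?C) = 0"
    by (subst (asm) sum_nonneg_eq_0_iff[OF finite_spanning_trees[OF G]])
  with S' have "pmf \<mu> S * (?W S - ?C) = 0" by blast
  with S show ?thesis by (simp add: set_pmf_eq)
qed

section \<open>Vulnerability\<close>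

lemma min_overlap_le:
  "finite_multigraph G \<Longrightarrow> T \<in> spanning_trees G \<Longrightarrow> min_overlap G J \<le> card (T \<inter> J)"
  unfolding min_overlap_def by (intro Min_le finite_imageI finite_spanning_trees) auto

text \<open>The minimum overlap is at most the mean overlap, which is the total usage of
  \<open>J\<close>.\<close>

lemma min_overlap_le_sum_edge_usage:
  assumes G: "finite_multigraph G" and \<mu>: "tree_pmf G \<mu>" and J: "J \<subseteq> edges G"
  shows "real (min_overlap G J) \<le> sum (edge_usage G \<mu>) J"
proof -
  have "real (min_overlap G J) = (\<Sum>\<gamma> \<in> spanning_trees G. pmf \<mu> \<gamma> * real (min_overlap G J))"
    by (simp add: sum_pmf_spanning_trees[OF G \<mu>] flip: sum_distrib_right)
  also have "\<dots> \<le> (\<Sum>\<gamma> \<in> spanning_trees G. pmf \<mu> \<gamma> * real (card (\<gamma> \<inter> J)))"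
    by (intro sum_mono mult_left_mono) (auto simp: min_overlap_le[OF G])
  finally show ?thesis by (simp add: expected_card[OF G J])
qed

lemma edge_usage_le_max_usage:
  "finite_multigraph G \<Longrightarrow> e \<in> edges G \<Longrightarrow> \<eta> e \<le> max_usage G \<eta>"
  unfolding max_usage_def by (intro Max_ge) (auto simp: finite_multigraph_def)

lemma vulnerability_le_max_usage:
  assumes G: "finite_multigraph G" and \<mu>: "tree_pmf G \<mu>" and J: "J \<subseteq> edges G" "J \<noteq> {}"
  shows "vulnerability G J \<le> max_usage G (edge_usage G \<mu>)"
proof -
  have "0 < card J"
    using G J finite_subset by (auto simp: finite_multigraph_def card_gt_0_iff)
  have "real (min_overlap G J) \<le> sum (edge_usage G \<mu>) J"
    by (rule min_overlap_le_sum_edge_usage[OF G \<mu> J(1)])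
  also have "\<dots> \<le> real (card J) * max_usage G (edge_usage G \<mu>)"
    using J edge_usage_le_max_usage[OF G, of _ "edge_usage G \<mu>"]
    by (intro sum_bounded_above) auto
  finally show ?thesis
    using \<open>0 < card J\<close> J(2) by (simp add: vulnerability_def divide_le_eq mult.commute)
qed

lemma max_usage_edges_nonempty:
  assumes "finite_multigraph G" "edges G \<noteq> {}"
  shows "max_usage_edges G \<eta> \<noteq> {}"
proof -
  have "max_usage G \<eta> \<in> \<eta> ` edges G"
    unfolding max_usage_def using assms by (intro Max_in) (auto simp: finite_multigraph_def)
  then show ?thesis by (auto simp: max_usage_edges_def)
qed

text \<open>Trees of the support have minimum weight for the usage, and \<open>K\<close> is closed
  upwards because no edge exceeds the maximum usage.\<close>

lemma FEU_optimal_support_overlap: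
  assumes G: "finite_multigraph G" and opt: "FEU_optimal G \<mu>" and S: "S \<in> set_pmf \<mu>"
  defines "K \<equiv> max_usage_edges G (edge_usage G \<mu>)"
  shows "card (S \<inter> K) = min_overlap G K"
proof (rule antisym)
  have S': "S \<in> spanning_trees G"
    using opt S by (auto simp: FEU_optimal_def tree_pmf_def)
  have "card (S \<inter> K) \<le> card (T \<inter> K)" if "T \<in> spanning_trees G" for T
    using G S' _ _ that
  proof (rule min_weight_tree_card_max_edges_le[where w = "edge_usage G \<mu>"])
    show "sum (edge_usage G \<mu>) S \<le> sum (edge_usage G \<mu>) T" if "T \<in> spanning_trees G" for T
      using FEU_optimal_support_weight[OF G opt S] FEU_optimal_weight_ge[OF G opt that] by simp
  next
    fix e f assume "e \<in> edges G" "f \<in> K" "edge_usage G \<mu> f \<le> edge_usage G \<mu> e"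
    then show "e \<in> K"
      using edge_usage_le_max_usage[OF G, of e "edge_usage G \<mu>"]
      by (auto simp: K_def max_usage_edges_def)
  qed
  then show "card (S \<inter> K) \<le> min_overlap G K"
    unfolding min_overlap_def using S' finite_spanning_trees[OF G] by (intro Min.boundedI) auto
  show "min_overlap G K \<le> card (S \<inter> K)" by (rule min_overlap_le[OF G S'])
qed

lemma vulnerability_max_usage_edges:
  assumes G: "finite_multigraph G" "edges G \<noteq> {}" and opt: "FEU_optimal G \<mu>"
  shows "vulnerability G (max_usage_edges G (edge_usage G \<mu>)) = max_usage G (edge_usage G \<mu>)"
proof -
  let ?\<eta> = "edge_usage G \<mu>"
  let ?K = "max_usage_edges G ?\<eta>"
  have \<mu>: "tree_pmf G \<mu>" using opt by (simp add: FEU_optimal_def)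
  have K: "?K \<subseteq> edges G" "?K \<noteq> {}"
    using max_usage_edges_nonempty[OF G] by (auto simp: max_usage_edges_def)
  have "card ?K \<noteq> 0"
    using K finite_subset[OF K(1)] G(1) by (simp add: finite_multigraph_def)
  have "sum ?\<eta> ?K = (\<Sum>\<gamma> \<in> spanning_trees G. pmf \<mu> \<gamma> * real (card (\<gamma> \<inter> ?K)))"
    by (simp add: expected_card[OF G(1) K(1)])
  also have "\<dots> = (\<Sum>\<gamma> \<in> spanning_trees G. pmf \<mu> \<gamma> * real (min_overlap G ?K))"
    \<comment> \<open>Trees outside the support have probability 0; on the support the overlap is
      constant.\<close>
    using FEU_optimal_support_overlap[OF G(1) opt] by (intro sum.cong) (auto simp: set_pmf_eq)
  also have "\<dots> = real (min_overlap G ?K)"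
    by (simp add: sum_pmf_spanning_trees[OF G(1) \<mu>] flip: sum_distrib_right)
  finally have "real (min_overlap G ?K) = real (card ?K) * max_usage G ?\<eta>"
    by (simp add: max_usage_edges_def)
  then show ?thesis
    using K \<open>card ?K \<noteq> 0\<close> by (simp add: vulnerability_def)
qed

lemma max_usage_nonneg:
  assumes "finite_multigraph G" "edges G \<noteq> {}"
  shows "0 \<le> max_usage G (edge_usage G \<mu>)"
proof -
  obtain e where "e \<in> edges G" using assms(2) by blast
  have "0 \<le> edge_usage G \<mu> e" by (simp add: edge_usage_def sum_nonneg)
  also have "\<dots> \<le> max_usage G (edge_usage G \<mu>)"
    by (rule edge_usage_le_max_usage[OF assms(1) \<open>e \<in> edges G\<close>])
  finally show ?thesis .
qed

lemma graph_vulnerability_eq_max_usage: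
  assumes G: "finite_multigraph G" "edges G \<noteq> {}" and opt: "FEU_optimal G \<mu>"
  shows "graph_vulnerability G = max_usage G (edge_usage G \<mu>)"
  unfolding graph_vulnerability_def
proof (rule Max_eqI)
  show "finite (vulnerability G ` Pow (edges G))"
    using G by (simp add: finite_multigraph_def)
  have "vulnerability G J \<le> max_usage G (edge_usage G \<mu>)" if "J \<subseteq> edges G" for J
  proof (cases "J = {}")
    \<comment> \<open>The empty set has vulnerability 0 by convention, so nonnegativity of the
      maximum usage is what is required.\<close>
    case True
    then show ?thesis using max_usage_nonneg[OF G] by (simp add: vulnerability_def)
  next
    case False
    then show ?thesis
      using vulnerability_le_max_usage[OF G(1) _ that] opt by (simp add: FEU_optimal_def)
  qed
  then show "x \<le> max_usage G (edge_usage G \<mu>)" if "x \<in> vulnerability G ` Pow (edges G)" for x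
    using that by blast
  have "max_usage_edges G (edge_usage G \<mu>) \<in> Pow (edges G)"
    by (auto simp: max_usage_edges_def)
  then show "max_usage G (edge_usage G \<mu>) \<in> vulnerability G ` Pow (edges G)"
    using vulnerability_max_usage_edges[OF assms] by (metis imageI)
qed

text \<open>Criticality makes the minimum overlap, and hence the total usage of \<open>J\<close>, at
  least \<open>card J * ?m\<close>. No usage exceeds \<open>?m\<close>, so the nonnegative gaps
  \<open>?m - ?\<eta> e\<close> sum to 0 and each vanishes.\<close>

lemma critical_set_edge_usage:
  assumes G: "finite_multigraph G" "edges G \<noteq> {}" and opt: "FEU_optimal G \<mu>"
    and J: "critical_set G J" and e: "e \<in> J"
  shows "edge_usage G \<mu> e = max_usage G (edge_usage G \<mu>)"
proof -
  let ?\<eta> = "edge_usage G \<mu>"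
  let ?m = "max_usage G ?\<eta>"
  have J': "J \<subseteq> edges G" "vulnerability G J = ?m"
    using J by (simp_all add: critical_set_def graph_vulnerability_eq_max_usage[OF G opt])
  have fin: "finite J"
    using finite_subset[OF J'(1)] G(1) by (simp add: finite_multigraph_def)
  have "J \<noteq> {}" using e by blast
  then have "real (min_overlap G J) / real (card J) = ?m"
    using J'(2) by (simp add: vulnerability_def)
  then have "real (min_overlap G J) = real (card J) * ?m"
    using fin \<open>J \<noteq> {}\<close> by (auto simp: field_simps)
  then have "(\<Sum>e \<in> J. ?m - ?\<eta> e) \<le> 0"
    using min_overlap_le_sum_edge_usage[OF G(1) _ J'(1), of \<mu>] opt
    by (simp add: FEU_optimal_def sum_subtractf)
  moreover have nonneg: "0 \<le> ?m - ?\<eta> e" if "e \<in> J" for e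
    using edge_usage_le_max_usage[OF G(1), of e ?\<eta>] J'(1) that by auto
  ultimately have "(\<Sum>e \<in> J. ?m - ?\<eta> e) = 0"
    by (intro antisym sum_nonneg) auto
  with sum_nonneg_eq_0_iff[OF fin nonneg] e show ?thesis by simp
qed

text \<open>The optimal probabilities enter as the usage of an arbitrary minimizer
  \<open>\<mu>\<close>, so the statement covers every optimal pmf.\<close>

theorem theorem6:
  fixes G :: "('v, 'e) multigraph" and \<mu> :: "'e set pmf" and \<eta> :: "'e \<Rightarrow> real" and J :: "'e set"
  assumes "finite_multigraph G"
    and "connected_multigraph G"
    and "edges G \<noteq> {}"
    and "FEU_optimal G \<mu>"
    and "\<eta> = edge_usage G \<mu>"
    and "critical_set G J"
  shows "\<forall>e \<in> J. \<eta> e = vulnerability G J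
           \<and> vulnerability G J = graph_vulnerability G
           \<and> graph_vulnerability G = vulnerability G (max_usage_edges G \<eta>)
           \<and> vulnerability G (max_usage_edges G \<eta>) = max_usage G \<eta>"
  using critical_set_edge_usage[OF assms(1,3,4,6)]
    graph_vulnerability_eq_max_usage[OF assms(1,3,4)]
    vulnerability_max_usage_edges[OF assms(1,3,4)] assms(5,6)
  by (simp add: critical_set_def)

end
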